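(* There are no minor minimal not apex (MMNA) graphs of connectivity one.
   Context: Graphs are finite, simple, undirected and have at least one vertex. A graph $H$ is a minor of $G$ if $H$ can be obtained by contracting edges in a subgraph of $G$ (after a contraction, doubled edges are replaced by a single edge so that the graph stays simple); a minor of $G$ is proper if it is not $G$ itself. $G-v$ is the graph obtained by deleting the vertex $v$ and its incident edges. A graph $G$ is not apex (NA) if $G-v$ is nonplanar for every vertex $v$. A graph is MMNA (minor minimal NA) if it is NA and no proper minor of it is NA. A $k$-cut is a set of $k$ vertices whose deletion leaves a disconnected graph. The connectivity $\kappa(G)$ is the largest integer $k$ such that $|V(G)|>k$ and $G$ has no $l$-cut with $l<k$ (so $\kappa(K_n)=n-1$). *)

theory Defs
  imports "HOL-Analysis.Analysis" "Graph_Theory.Graph_Theory"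
begin

text \<open>
  A simple undirected graph is a symmetric loop-free set of ordered pairs (locale
  \<open>pair_graph\<close>), so that an edge between \<open>u\<close> and \<open>v\<close> is the pair of arcs
  \<open>(u, v)\<close>, \<open>(v, u)\<close>. The locale itself admits the graph without vertices.
\<close>

definition simple_graph :: "'a pair_pre_digraph \<Rightarrow> bool" where
  "simple_graph G \<longleftrightarrow> pair_graph G \<and> pverts G \<noteq> {}"

definition delete_verts :: "'a pair_pre_digraph \<Rightarrow> 'a set \<Rightarrow> 'a pair_pre_digraph" where
  "delete_verts G S =
     \<lparr> pverts = pverts G - S,
       parcs = {(x, y) \<in> parcs G. x \<notin> S \<and> y \<notin> S} \<rparr>"

text \<open>
  The vertex resulting from the contraction of the edge between \<open>u\<close> and \<open>v\<close> is
  again called \<open>u\<close>. The edge itself disappears, and doubled edges coincide.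
\<close>

definition contract_edge :: "'a pair_pre_digraph \<Rightarrow> 'a \<Rightarrow> 'a \<Rightarrow> 'a pair_pre_digraph" where
  "contract_edge G u v =
     (let f = (\<lambda>x. if x = v then u else x) in
      \<lparr> pverts = pverts G - {v},
        parcs = {(f x, f y) | x y. (x, y) \<in> parcs G \<and> f x \<noteq> f y} \<rparr>)"

inductive minor :: "'a pair_pre_digraph \<Rightarrow> 'a pair_pre_digraph \<Rightarrow> bool"
  for G :: "'a pair_pre_digraph" where
  subgraph: "minor G H" if "simple_graph H" "subgraph H G"
| contract: "minor G (contract_edge H u v)" if "minor G H" "(u, v) \<in> parcs H"

text \<open>
  \<open>minor G H\<close> reads: \<open>H\<close> is a minor of \<open>G\<close>. Minors keep vertex names from \<open>G\<close>, and
  every deletion or contraction lowers the number of vertices or of edges, so a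
  minor that is different from \<open>G\<close> is not isomorphic to \<open>G\<close> either.
\<close>

definition proper_minor :: "'a pair_pre_digraph \<Rightarrow> 'a pair_pre_digraph \<Rightarrow> bool" where
  "proper_minor G H \<longleftrightarrow> minor G H \<and> H \<noteq> G"

text \<open>
  Embeddability in the plane: \<open>p\<close> places the vertices, and \<open>c {u, v}\<close> is the simple
  arc drawing the edge between \<open>u\<close> and \<open>v\<close>, in either orientation.
\<close>

definition plane_drawing ::
  "'a pair_pre_digraph \<Rightarrow> ('a \<Rightarrow> complex) \<Rightarrow> ('a set \<Rightarrow> real \<Rightarrow> complex) \<Rightarrow> bool" where
  "plane_drawing G p c \<longleftrightarrow>
     inj_on p (pverts G) \<and>
     (\<forall>(u, v) \<in> parcs G.
        arc (c {u, v}) \<and>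
        {pathstart (c {u, v}), pathfinish (c {u, v})} = {p u, p v} \<and>
        path_image (c {u, v}) \<inter> p ` pverts G = {p u, p v}) \<and>
     (\<forall>(u, v) \<in> parcs G. \<forall>(x, y) \<in> parcs G. {u, v} \<noteq> {x, y} \<longrightarrow>
        path_image (c {u, v}) \<inter> path_image (c {x, y}) \<subseteq> p ` ({u, v} \<inter> {x, y}))"

definition planar :: "'a pair_pre_digraph \<Rightarrow> bool" where
  "planar G \<longleftrightarrow> (\<exists>p c. plane_drawing G p c)"

definition not_apex :: "'a pair_pre_digraph \<Rightarrow> bool" where
  "not_apex G \<longleftrightarrow> simple_graph G \<and> (\<forall>v \<in> pverts G. \<not> planar (delete_verts G {v}))"

definition MMNA :: "'a pair_pre_digraph \<Rightarrow> bool" where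
  "MMNA G \<longleftrightarrow> not_apex G \<and> (\<forall>H. proper_minor G H \<longrightarrow> \<not> not_apex H)"

text \<open>
  A cut must leave at least one vertex. Note that \<open>connected\<close> without qualifier is
  ambiguous with topological connectedness.
\<close>

definition is_cut :: "'a pair_pre_digraph \<Rightarrow> nat \<Rightarrow> 'a set \<Rightarrow> bool" where
  "is_cut G k S \<longleftrightarrow>
     S \<subset> pverts G \<and> card S = k \<and> \<not> Digraph_Component.connected (delete_verts G S)"

definition connectivity :: "'a pair_pre_digraph \<Rightarrow> nat" where
  "connectivity G =
     (GREATEST k. k < card (pverts G) \<and> (\<forall>l < k. \<not> (\<exists>S. is_cut G l S)))"

end

theory Submission
  imports Defs
begin

text \<open>
  Gluing two planar graphs at a single vertex gives a planar graph. To glue drawings made of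
  arbitrary arcs, redraw the edges at the vertex \<open>x\<close> as radii of a small disc, so that some
  segment from \<open>x\<close> to a point \<open>q\<close> meets the drawing in \<open>x\<close> only. The map
  \<open>z \<mapsto> (z - x) / (z - q)\<close> sends this segment to the nonpositive reals, and the principal
  square root then moves the drawing into the open right half plane, with \<open>x\<close> at \<open>0\<close>. The
  second drawing goes into the left half plane.

  Now let \<open>x\<close> separate the MMNA graph \<open>G\<close> into \<open>A\<close> and \<open>B\<close>. One side without \<open>x\<close>, say \<open>A\<close>, is
  nonplanar. If \<open>B\<close> with \<open>x\<close> were nonplanar as well, deleting the edges between \<open>x\<close> and \<open>A\<close>
  would leave a proper minor that is not apex. So \<open>B\<close> with \<open>x\<close> is planar. By minimality, deleting
  some vertex \<open>w\<close> makes \<open>A\<close> with \<open>x\<close> planar, and \<open>w\<close> lies in \<open>A\<close>; then \<open>G - w\<close> is a planar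
  graph glued to a planar graph at \<open>x\<close>.
\<close>

section \<open>Plane drawings and the points they occupy\<close>

text \<open>Vertices are listed besides the arcs because an isolated vertex lies on no arc.\<close>

definition drawing_points ::
  "'a pair_pre_digraph \<Rightarrow> ('a \<Rightarrow> complex) \<Rightarrow> ('a set \<Rightarrow> real \<Rightarrow> complex) \<Rightarrow> complex set" where
  "drawing_points G p c = p ` pverts G \<union> (\<Union>(u, v) \<in> parcs G. path_image (c {u, v}))"

lemma drawing_pointsI:
  "v \<in> pverts G \<Longrightarrow> p v \<in> drawing_points G p c"
  "(u, v) \<in> parcs G \<Longrightarrow> z \<in> path_image (c {u, v}) \<Longrightarrow> z \<in> drawing_points G p c"
  unfolding drawing_points_def by auto

lemma drawing_pointsE:
  assumes "z \<in> drawing_points G p c"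
  obtains v where "v \<in> pverts G" "z = p v"
    | u v where "(u, v) \<in> parcs G" "z \<in> path_image (c {u, v})"
  using assms unfolding drawing_points_def by auto

lemma plane_drawingD:
  assumes "plane_drawing G p c"
  shows "inj_on p (pverts G)"
    and "(u, v) \<in> parcs G \<Longrightarrow> arc (c {u, v})"
    and "(u, v) \<in> parcs G \<Longrightarrow> {pathstart (c {u, v}), pathfinish (c {u, v})} = {p u, p v}"
    and "(u, v) \<in> parcs G \<Longrightarrow> path_image (c {u, v}) \<inter> p ` pverts G = {p u, p v}"
    and "(u, v) \<in> parcs G \<Longrightarrow> (x, y) \<in> parcs G \<Longrightarrow> {u, v} \<noteq> {x, y} \<Longrightarrow>
      path_image (c {u, v}) \<inter> path_image (c {x, y}) \<subseteq> p ` ({u, v} \<inter> {x, y})"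
  using assms unfolding plane_drawing_def by blast+

lemma plane_drawingI:
  assumes "inj_on p (pverts G)"
    and "\<And>u v. (u, v) \<in> parcs G \<Longrightarrow> arc (c {u, v})"
    and "\<And>u v. (u, v) \<in> parcs G \<Longrightarrow>
      {pathstart (c {u, v}), pathfinish (c {u, v})} = {p u, p v}"
    and "\<And>u v. (u, v) \<in> parcs G \<Longrightarrow> path_image (c {u, v}) \<inter> p ` pverts G = {p u, p v}"
    and "\<And>u v x y. (u, v) \<in> parcs G \<Longrightarrow> (x, y) \<in> parcs G \<Longrightarrow> {u, v} \<noteq> {x, y} \<Longrightarrow>
      path_image (c {u, v}) \<inter> path_image (c {x, y}) \<subseteq> p ` ({u, v} \<inter> {x, y})"
  shows "plane_drawing G p c"
  unfolding plane_drawing_def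
proof (intro conjI ballI, goal_cases)
  case 1
  show ?case by (rule assms(1))
next
  case (2 e)
  then show ?case
    using assms(2-4) by (cases e) simp
next
  case (3 e)
  then show ?case
    using assms(5)[of "fst e" "snd e" "fst f" "snd f" for f] by (simp add: case_prod_beta)
qed

section \<open>Elementary form of the graph axioms\<close>

lemma pair_graph_iff:
  "pair_graph G \<longleftrightarrow> finite (pverts G) \<and>
     (\<forall>u v. (u, v) \<in> parcs G \<longrightarrow>
        u \<in> pverts G \<and> v \<in> pverts G \<and> u \<noteq> v \<and> (v, u) \<in> parcs G)"
proof
  assume "pair_graph G"
  then interpret pair_graph G .
  show "finite (pverts G) \<and> (\<forall>u v. (u, v) \<in> parcs G \<longrightarrow>
      u \<in> pverts G \<and> v \<in> pverts G \<and> u \<noteq> v \<and> (v, u) \<in> parcs G)"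
    using pair_finite_verts in_arcsD1 in_arcsD2 pair_no_loops pair_sym_arcs
    by (force simp: symmetric_def sym_def)
next
  assume *: "finite (pverts G) \<and> (\<forall>u v. (u, v) \<in> parcs G \<longrightarrow>
      u \<in> pverts G \<and> v \<in> pverts G \<and> u \<noteq> v \<and> (v, u) \<in> parcs G)"
  then have "parcs G \<subseteq> pverts G \<times> pverts G"
    by auto
  then have "finite (parcs G)"
    using * by (meson finite_SigmaI finite_subset)
  then show "pair_graph G"
    using * by unfold_locales (auto simp: symmetric_def sym_def)
qed

lemma pair_graphD:
  assumes "pair_graph G"
  shows "finite (pverts G)" and "finite (parcs G)"
    and "(u, v) \<in> parcs G \<Longrightarrow> u \<in> pverts G"
    and "(u, v) \<in> parcs G \<Longrightarrow> v \<in> pverts G"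
    and "(u, v) \<in> parcs G \<Longrightarrow> u \<noteq> v"
    and "(u, v) \<in> parcs G \<Longrightarrow> (v, u) \<in> parcs G"
  using assms pair_graph_iff[of G]
    pair_fin_digraph.pair_finite_arcs[of G]
  by (auto simp: pair_graph_def pair_digraph_def)

section \<open>Restricting drawings and mapping them injectively\<close>

text \<open>A drawing is tested only at the vertices and edges of its graph. Hence two drawings can
  be merged by a case distinction and each of them recovered from the result.\<close>

lemma plane_drawing_cong:
  assumes d: "plane_drawing G p c" and G: "pair_graph G"
    and p: "\<And>v. v \<in> pverts G \<Longrightarrow> p' v = p v"
    and c: "\<And>u v. (u, v) \<in> parcs G \<Longrightarrow> c' {u, v} = c {u, v}"
  shows "plane_drawing G p' c'" and "drawing_points G p' c' = drawing_points G p c"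
proof -
  note wf = pair_graphD(3,4)[OF G]
  have im: "p' ` pverts G = p ` pverts G"
    using p by (rule image_cong[OF refl])
  show "plane_drawing G p' c'"
  proof (rule plane_drawingI)
    show "inj_on p' (pverts G)"
      using plane_drawingD(1)[OF d] p by (simp add: inj_on_def)
  next
    fix u v assume uv: "(u, v) \<in> parcs G"
    show "arc (c' {u, v})" "{pathstart (c' {u, v}), pathfinish (c' {u, v})} = {p' u, p' v}"
      "path_image (c' {u, v}) \<inter> p' ` pverts G = {p' u, p' v}"
      using plane_drawingD(2-4)[OF d uv] wf[OF uv] by (simp_all add: c[OF uv] p im)
  next
    fix u v x y assume *: "(u, v) \<in> parcs G" "(x, y) \<in> parcs G" "{u, v} \<noteq> {x, y}"
    have "p' ` ({u, v} \<inter> {x, y}) = p ` ({u, v} \<inter> {x, y})"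
      using p wf *(1) by (intro image_cong) auto
    then show "path_image (c' {u, v}) \<inter> path_image (c' {x, y}) \<subseteq> p' ` ({u, v} \<inter> {x, y})"
      using plane_drawingD(5)[OF d *] by (simp add: c *)
  qed
  show "drawing_points G p' c' = drawing_points G p c"
    unfolding drawing_points_def im using c by (auto 4 4)
qed

text \<open>The same drawing serves: dropping vertices and edges violates no condition, as both ends
  of every remaining edge remain.\<close>

lemma planar_mono:
  assumes "planar G" "pair_graph H" "pverts H \<subseteq> pverts G" "parcs H \<subseteq> parcs G"
  shows "planar H"
proof -
  obtain p c where d: "plane_drawing G p c"
    using assms(1) unfolding planar_def by blast
  have "plane_drawing H p c"
  proof (rule plane_drawingI)
    show "inj_on p (pverts H)"
      using plane_drawingD(1)[OF d] assms(3) inj_on_subset by blast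
  next
    fix u v assume uv: "(u, v) \<in> parcs H"
    then have uvG: "(u, v) \<in> parcs G"
      using assms(4) by blast
    show "arc (c {u, v})" "{pathstart (c {u, v}), pathfinish (c {u, v})} = {p u, p v}"
      using plane_drawingD(2,3)[OF d uvG] by auto
    show "path_image (c {u, v}) \<inter> p ` pverts H = {p u, p v}"
      using plane_drawingD(4)[OF d uvG] assms(3) pair_graphD(3,4)[OF assms(2) uv] by blast
  next
    fix u v x y assume "(u, v) \<in> parcs H" "(x, y) \<in> parcs H" "{u, v} \<noteq> {x, y}"
    then show "path_image (c {u, v}) \<inter> path_image (c {x, y}) \<subseteq> p ` ({u, v} \<inter> {x, y})"
      using plane_drawingD(5)[OF d] assms(4) by blast
  qed
  then show ?thesis
    unfolding planar_def by blast
qed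

text \<open>An injective map commutes with intersections, so each condition carries over. The
  requirements on \<open>f\<close> are confined to a set containing the drawing because the square
  root used later is not continuous on the whole plane.\<close>

lemma plane_drawing_image:
  assumes d: "plane_drawing G p c" and G: "pair_graph G"
    and cont: "continuous_on S f" and inj: "inj_on f S"
    and sub: "drawing_points G p c \<subseteq> S"
  shows "plane_drawing G (f \<circ> p) (\<lambda>e. f \<circ> c e)"
    and "drawing_points G (f \<circ> p) (\<lambda>e. f \<circ> c e) = f ` drawing_points G p c"
proof -
  have vS: "p ` pverts G \<subseteq> S"
    using sub by (auto simp: drawing_points_def)
  have cS: "path_image (c {u, v}) \<subseteq> S" if "(u, v) \<in> parcs G" for u v
    using sub that by (auto simp: drawing_points_def)
  show "plane_drawing G (f \<circ> p) (\<lambda>e. f \<circ> c e)"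
  proof (rule plane_drawingI)
    show "inj_on (f \<circ> p) (pverts G)"
      using plane_drawingD(1)[OF d] inj vS by (meson comp_inj_on inj_on_subset)
  next
    fix u v assume uv: "(u, v) \<in> parcs G"
    show "arc (f \<circ> c {u, v})"
      using plane_drawingD(2)[OF d uv] cS[OF uv] cont inj unfolding arc_def path_image_def
      by (auto intro!: path_continuous_image comp_inj_on
          intro: continuous_on_subset inj_on_subset simp: path_image_def)
    show "{pathstart (f \<circ> c {u, v}), pathfinish (f \<circ> c {u, v})} = {(f \<circ> p) u, (f \<circ> p) v}"
      using arg_cong[OF plane_drawingD(3)[OF d uv], of "image f"]
      by (simp add: pathstart_compose pathfinish_compose)
    have "f ` path_image (c {u, v}) \<inter> f ` p ` pverts G = f ` (path_image (c {u, v}) \<inter> p ` pverts G)"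
      using inj_on_image_Int[OF inj cS[OF uv] vS] by simp
    then show "path_image (f \<circ> c {u, v}) \<inter> (f \<circ> p) ` pverts G = {(f \<circ> p) u, (f \<circ> p) v}"
      using plane_drawingD(4)[OF d uv] by (simp add: path_image_compose image_comp)
  next
    fix u v x y assume *: "(u, v) \<in> parcs G" "(x, y) \<in> parcs G" "{u, v} \<noteq> {x, y}"
    have "f ` path_image (c {u, v}) \<inter> f ` path_image (c {x, y})
        = f ` (path_image (c {u, v}) \<inter> path_image (c {x, y}))"
      using inj_on_image_Int[OF inj cS[OF *(1)] cS[OF *(2)]] by simp
    also have "\<dots> \<subseteq> f ` p ` ({u, v} \<inter> {x, y})"
      using plane_drawingD(5)[OF d *] by (rule image_mono)
    finally show "path_image (f \<circ> c {u, v}) \<inter> path_image (f \<circ> c {x, y})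
        \<subseteq> (f \<circ> p) ` ({u, v} \<inter> {x, y})"
      by (simp add: path_image_compose image_comp)
  qed
  show "drawing_points G (f \<circ> p) (\<lambda>e. f \<circ> c e) = f ` drawing_points G p c"
    by (force simp: drawing_points_def path_image_compose)
qed

section \<open>Merging two drawings that share at most one vertex\<close>

text \<open>By \<open>meet\<close>, the two drawings have only images of shared vertices in common,
  so edges of different parts can meet only there. Bounding the shared vertices by
  \<open>{x}\<close> covers disjoint unions and gluing at a vertex alike.\<close>

lemma planar_union:
  assumes d1: "plane_drawing G1 p1 c1" and d2: "plane_drawing G2 p2 c2"
    and G1: "pair_graph G1" and G2: "pair_graph G2"
    and verts: "pverts G = pverts G1 \<union> pverts G2" and arcs: "parcs G = parcs G1 \<union> parcs G2"
    and common: "pverts G1 \<inter> pverts G2 \<subseteq> {x}"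
    and agree: "\<And>v. v \<in> pverts G1 \<inter> pverts G2 \<Longrightarrow> p1 v = p2 v"
    and meet: "drawing_points G1 p1 c1 \<inter> drawing_points G2 p2 c2 \<subseteq> p1 ` (pverts G1 \<inter> pverts G2)"
  shows "planar G"
proof -
  define p where "p v = (if v \<in> pverts G1 then p1 v else p2 v)" for v
  \<comment> \<open>An edge of \<open>G2\<close> has distinct ends, at most one of them shared, so
    among all edges the test \<open>e \<subseteq> pverts G1\<close> singles out those of
    \<open>G1\<close>.\<close>
  define c where "c e = (if e \<subseteq> pverts G1 then c1 e else c2 e)" for e
  have p1: "p v = p1 v" if "v \<in> pverts G1" for v
    using that by (simp add: p_def)
  have p2: "p v = p2 v" if "v \<in> pverts G2" for v
    using that agree by (simp add: p_def)
  have c1: "c {u, v} = c1 {u, v}" if "(u, v) \<in> parcs G1" for u v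
    using that pair_graphD(3,4)[OF G1] by (simp add: c_def)
  have c2: "c {u, v} = c2 {u, v}" if "(u, v) \<in> parcs G2" for u v
    using that pair_graphD(3,4,5)[OF G2 that] common by (auto simp: c_def)
  have d1': "plane_drawing G1 p c" "drawing_points G1 p c = drawing_points G1 p1 c1"
    by (rule plane_drawing_cong[OF d1 G1]; simp add: p1 c1)+
  have d2': "plane_drawing G2 p c" "drawing_points G2 p c = drawing_points G2 p2 c2"
    by (rule plane_drawing_cong[OF d2 G2]; simp add: p2 c2)+
  have "p ` (pverts G1 \<inter> pverts G2) = p1 ` (pverts G1 \<inter> pverts G2)"
    using p1 by (intro image_cong) auto
  then have meet': "drawing_points G1 p c \<inter> drawing_points G2 p c \<subseteq> p ` (pverts G1 \<inter> pverts G2)"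
    using meet unfolding d1'(2) d2'(2) by simp
  note w1 = pair_graphD(3,4)[OF G1] and w2 = pair_graphD(3,4)[OF G2]
  note i1 = plane_drawingD(1)[OF d1'(1)] and i2 = plane_drawingD(1)[OF d2'(1)]
  have inj: "inj_on p (pverts G)"
  proof -
    \<comment> \<open>The point \<open>p u\<close> belongs to both drawings, so it is the image of a
      shared vertex; injectivity on each part identifies that vertex with \<open>u\<close> and with
      \<open>v\<close>.\<close>
    have "u = v" if "u \<in> pverts G1" "v \<in> pverts G2" "p u = p v" for u v
    proof -
      have "p u \<in> drawing_points G1 p c \<inter> drawing_points G2 p c"
        using drawing_pointsI(1)[OF that(1), of p c] drawing_pointsI(1)[OF that(2), of p c] that(3)
        by simp
      then obtain w where "w \<in> pverts G1" "w \<in> pverts G2" "p u = p w"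
        using meet' by blast
      then show ?thesis
        using that i1 i2 by (metis inj_onD)
    qed
    then show ?thesis
      using i1 i2 unfolding verts inj_on_def by (metis Un_iff)
  qed
  \<comment> \<open>A common point is the image of a shared vertex \<open>w\<close>, and an arc
    contains no vertices but its ends, so \<open>w\<close> is an end of both edges.\<close>
  have cross: "path_image (c {u, v}) \<inter> path_image (c {x, y}) \<subseteq> p ` ({u, v} \<inter> {x, y})"
    if "(u, v) \<in> parcs G1" "(x, y) \<in> parcs G2" for u v x y
  proof
    fix z assume z: "z \<in> path_image (c {u, v}) \<inter> path_image (c {x, y})"
    then have "z \<in> drawing_points G1 p c \<inter> drawing_points G2 p c"
      using drawing_pointsI(2)[OF that(1)] drawing_pointsI(2)[OF that(2)] by blast
    then obtain w where w: "w \<in> pverts G1" "w \<in> pverts G2" "z = p w"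
      using meet' by blast
    then have "p w \<in> {p u, p v}" "p w \<in> {p x, p y}"
      using z plane_drawingD(4)[OF d1'(1) that(1)] plane_drawingD(4)[OF d2'(1) that(2)] by blast+
    then have "w \<in> {u, v}" "w \<in> {x, y}"
      using w i1 i2 w1[OF that(1)] w2[OF that(2)] by (auto dest: inj_onD)
    then show "z \<in> p ` ({u, v} \<inter> {x, y})"
      using w by blast
  qed
  have "plane_drawing G p c"
  proof (rule plane_drawingI)
    show "inj_on p (pverts G)" by (rule inj)
  next
    fix u v assume uv: "(u, v) \<in> parcs G"
    show "arc (c {u, v})" "{pathstart (c {u, v}), pathfinish (c {u, v})} = {p u, p v}"
      using uv arcs plane_drawingD(2,3)[OF d1'(1)] plane_drawingD(2,3)[OF d2'(1)] by blast+
    show "path_image (c {u, v}) \<inter> p ` pverts G = {p u, p v}"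
    proof (cases "(u, v) \<in> parcs G1")
      case True
      then have "path_image (c {u, v}) \<inter> p ` pverts G2 \<subseteq> p ` pverts G1"
        using meet' unfolding drawing_points_def by blast
      then show ?thesis
        using plane_drawingD(4)[OF d1'(1) True] unfolding verts by blast
    next
      case False
      then have uv: "(u, v) \<in> parcs G2"
        using uv arcs by blast
      then have "path_image (c {u, v}) \<inter> p ` pverts G1 \<subseteq> p ` pverts G2"
        using meet' unfolding drawing_points_def by blast
      then show ?thesis
        using plane_drawingD(4)[OF d2'(1) uv] unfolding verts by blast
    qed
  next
    fix u v x y assume *: "(u, v) \<in> parcs G" "(x, y) \<in> parcs G" "{u, v} \<noteq> {x, y}"
    then consider "(u, v) \<in> parcs G1" "(x, y) \<in> parcs G1" | "(u, v) \<in> parcs G1" "(x, y) \<in> parcs G2"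
      | "(u, v) \<in> parcs G2" "(x, y) \<in> parcs G1" | "(u, v) \<in> parcs G2" "(x, y) \<in> parcs G2"
      using arcs by blast
    then show "path_image (c {u, v}) \<inter> path_image (c {x, y}) \<subseteq> p ` ({u, v} \<inter> {x, y})"
      using plane_drawingD(5)[OF d1'(1) _ _ *(3)] plane_drawingD(5)[OF d2'(1) _ _ *(3)]
        cross[of u v x y] cross[of x y u v] by cases (auto simp: Int_commute)
  qed
  then show ?thesis
    unfolding planar_def by blast
qed

section \<open>Compactness of drawings and disjoint unions\<close>

lemma compact_drawing_points:
  assumes "plane_drawing G p c" "pair_graph G"
  shows "compact (drawing_points G p c)"
  unfolding drawing_points_def
  using pair_graphD(1,2)[OF assms(2)] plane_drawingD(2)[OF assms(1)]
  by (intro compact_Un) (auto intro!: compact_UN compact_arc_image intro: finite_imp_compact)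

text \<open>A drawing is compact, hence bounded by some \<open>B\<close>; shifting by
  \<open>B + 1\<close> makes all real parts strictly positive.\<close>

lemma planar_right_half_plane:
  assumes "planar G" "pair_graph G"
  obtains p c where "plane_drawing G p c" "drawing_points G p c \<subseteq> {z. Re z > 0}"
proof -
  obtain p c where d: "plane_drawing G p c"
    using assms(1) unfolding planar_def by blast
  obtain B where B: "\<And>z. z \<in> drawing_points G p c \<Longrightarrow> norm z \<le> B"
    using compact_drawing_points[OF d assms(2)] compact_imp_bounded bounded_iff by metis
  define f where "f z = z + complex_of_real (B + 1)" for z
  have f: "continuous_on UNIV f" "inj_on f UNIV"
    unfolding f_def by (auto intro!: continuous_intros simp: inj_on_def)
  have "Re (f z) > 0" if "z \<in> drawing_points G p c" for z
    using B[OF that] abs_Re_le_cmod[of z] by (simp add: f_def)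
  then show thesis
    using that[OF plane_drawing_image(1)[OF d assms(2) f]]
      plane_drawing_image(2)[OF d assms(2) f] by auto
qed

text \<open>Both drawings are moved to the right half plane, and \<open>uminus\<close> then takes
  one of them to the left half plane.\<close>

lemma planar_disjoint_union:
  assumes "planar G1" "planar G2" and G1: "pair_graph G1" and G2: "pair_graph G2"
    and "pverts G = pverts G1 \<union> pverts G2" "parcs G = parcs G1 \<union> parcs G2"
    and "pverts G1 \<inter> pverts G2 = {}"
  shows "planar G"
proof -
  obtain p1 c1 where d1: "plane_drawing G1 p1 c1" "drawing_points G1 p1 c1 \<subseteq> {z. Re z > 0}"
    using planar_right_half_plane[OF assms(1) G1] by blast
  obtain p2 c2 where d2: "plane_drawing G2 p2 c2" "drawing_points G2 p2 c2 \<subseteq> {z. Re z > 0}"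
    using planar_right_half_plane[OF assms(2) G2] by blast
  have f: "continuous_on UNIV (uminus :: complex \<Rightarrow> complex)" "inj_on (uminus :: complex \<Rightarrow> complex) UNIV"
    by (auto intro: continuous_intros)
  note d2' = plane_drawing_image[OF d2(1) G2 f subset_UNIV]
  have "Re z < 0" if "z \<in> drawing_points G2 (uminus \<circ> p2) (\<lambda>e. uminus \<circ> c2 e)" for z
    using that d2(2) unfolding d2'(2) by auto
  then have "drawing_points G1 p1 c1 \<inter> drawing_points G2 (uminus \<circ> p2) (\<lambda>e. uminus \<circ> c2 e) = {}"
    using d1(2) less_asym by blast
  then show ?thesis
    using planar_union[OF d1(1) d2'(1) G1 G2 assms(5,6)] assms(7) by simp
qed

section \<open>Straightening the edges near a vertex\<close>

text \<open>The other vertices and the edges not at \<open>x\<close> form a compact set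
  \<open>K\<close> that misses \<open>p x\<close>, so the open complement of \<open>K\<close>
  contains a closed ball around \<open>p x\<close>.\<close>

lemma ball_avoiding_rest:
  assumes d: "plane_drawing G p c" and G: "pair_graph G" and x: "x \<in> pverts G"
  obtains R where "R > 0" "cball (p x) R \<inter> p ` pverts G = {p x}"
    "\<And>u v. (u, v) \<in> parcs G \<Longrightarrow> x \<notin> {u, v} \<Longrightarrow> cball (p x) R \<inter> path_image (c {u, v}) = {}"
proof -
  define K where "K = p ` (pverts G - {x}) \<union>
    (\<Union>(u, v) \<in> {(u, v) \<in> parcs G. x \<notin> {u, v}}. path_image (c {u, v}))"
  have "finite {(u, v) \<in> parcs G. x \<notin> {u, v}}"
    using pair_graphD(2)[OF G] by (rule rev_finite_subset) auto
  then have "compact K"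
    unfolding K_def using pair_graphD(1)[OF G] plane_drawingD(2)[OF d]
    by (intro compact_Un) (auto intro!: compact_UN compact_arc_image intro: finite_imp_compact)
  moreover have "p x \<notin> K"
  proof
    assume "p x \<in> K"
    then consider v where "v \<in> pverts G" "v \<noteq> x" "p x = p v"
      | u v where "(u, v) \<in> parcs G" "x \<notin> {u, v}" "p x \<in> path_image (c {u, v})"
      unfolding K_def by auto
    then show False
    proof cases
      case 1
      then show ?thesis
        using plane_drawingD(1)[OF d] x by (auto dest: inj_onD)
    next
      case 2
      then have "p x \<in> {p u, p v}"
        using plane_drawingD(4)[OF d 2(1)] x by blast
      then show ?thesis
        using plane_drawingD(1)[OF d] x 2(2) pair_graphD(3,4)[OF G 2(1)] by (auto dest: inj_onD)
    qed
  qed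
  ultimately obtain R where R: "R > 0" "cball (p x) R \<subseteq> - K"
    using open_contains_cball[of "- K"] compact_imp_closed open_Compl by (metis ComplI)
  show thesis
  proof (rule that[OF R(1)])
    show "cball (p x) R \<inter> p ` pverts G = {p x}"
      using R x unfolding K_def by auto
    show "cball (p x) R \<inter> path_image (c {u, v}) = {}" if "(u, v) \<in> parcs G" "x \<notin> {u, v}" for u v
      using R(2) that unfolding K_def by auto
  qed
qed

text \<open>The arc is followed from its start to its first point on the ball. With the complement
  of the open ball as \<open>?S\<close>, the frontier is the sphere and the interior is the outside
  of the closed ball.\<close>

lemma arc_initial_segment_outside_ball:
  fixes a :: "'a :: euclidean_space"
  assumes g: "arc g" "pathfinish g = a" and R: "R > 0" "dist a (pathstart g) > R"
  obtains h where "arc h" "pathstart h = pathstart g" "path_image h \<subseteq> path_image g"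
    "path_image h \<inter> cball a R = {pathfinish h}" "dist a (pathfinish h) = R"
proof -
  let ?S = "- ball a R"
  have S: "interior ?S = - cball a R" "frontier ?S = sphere a R"
    using R(1) by (simp_all add: interior_complement frontier_complement)
  obtain u where u: "0 \<le> u" "u \<le> 1" "g u \<in> frontier ?S"
    "path_image (subpath 0 u g) - {g u} \<subseteq> interior ?S"
  proof (rule subpath_to_frontier[of g ?S])
    show "path g"
      using g(1) by (rule arc_imp_path)
    show "pathstart g \<in> closure ?S"
      using R(2) closure_subset[of ?S] by auto
    show "pathfinish g \<notin> ?S"
      using g(2) R(1) by simp
  qed
  have gu: "dist a (g u) = R"
    using u(3) S by simp
  \<comment> \<open>Otherwise the subpath would be constant and no arc.\<close>
  have "u \<noteq> 0"
    using gu R(2) by (auto simp: pathstart_def)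
  show thesis
  proof (rule that)
    show "arc (subpath 0 u g)"
      using g(1) u \<open>u \<noteq> 0\<close> by (intro arc_subpath_arc) auto
    show "path_image (subpath 0 u g) \<subseteq> path_image g"
      using u by (intro path_image_subpath_subset) auto
    have "g u \<in> path_image (subpath 0 u g)"
      by (metis pathfinish_in_path_image pathfinish_subpath)
    then show "path_image (subpath 0 u g) \<inter> cball a R = {pathfinish (subpath 0 u g)}"
      using u(4) gu S by auto
  qed (use gu in \<open>auto simp: pathstart_def subpath_def pathfinish_def\<close>)
qed

text \<open>A common point is \<open>a\<close> plus nonnegative multiples \<open>s\<close> and
  \<open>t\<close> of two vectors of equal length, so \<open>s = t\<close>; as the vectors differ,
  \<open>s = 0\<close>.\<close>

lemma radii_meet_at_centre:
  fixes a :: "'a :: euclidean_space"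
  assumes "dist a z = R" "dist a w = R" "z \<noteq> w" "R > 0"
  shows "closed_segment a z \<inter> closed_segment a w = {a}"
proof -
  have "y = a" if y: "y \<in> closed_segment a z" "y \<in> closed_segment a w" for y
  proof -
    obtain s t where s: "0 \<le> s" "y - a = s *\<^sub>R (z - a)" and t: "0 \<le> t" "y - a = t *\<^sub>R (w - a)"
    proof -
      have "\<exists>r\<ge>0. y - a = r *\<^sub>R (b - a)" if "y \<in> closed_segment a b" for b
        using that unfolding in_segment by (auto simp: algebra_simps)
      then show thesis
        using that y by blast
    qed
    have "norm (z - a) = R" "norm (w - a) = R"
      using assms(1,2) by (simp_all add: dist_norm norm_minus_commute)
    then have "norm (y - a) = s * R" "norm (y - a) = t * R"
      using arg_cong[OF s(2), of norm] arg_cong[OF t(2), of norm] s(1) t(1) by simp_all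
    then have "s = t"
      using assms(4) by auto
    then have "s *\<^sub>R (z - a) = s *\<^sub>R (w - a)"
      using s(2) t(2) by metis
    then have "s = 0"
      using assms(3) by simp
    then show ?thesis
      using s(2) by simp
  qed
  then show ?thesis by auto
qed

text \<open>Each edge at \<open>x\<close> is followed from its far end to a small disc around
  \<open>p x\<close> and continued along a radius. These are finitely many radii, so some other
  radius is free.\<close>

lemma planar_free_segment:
  assumes "planar G" and G: "pair_graph G" and x: "x \<in> pverts G"
  obtains p c q where "plane_drawing G p c" "q \<noteq> p x"
    "closed_segment (p x) q \<inter> drawing_points G p c \<subseteq> {p x}"
proof -
  obtain p c where d: "plane_drawing G p c"
    using assms(1) unfolding planar_def by blast
  note inj = plane_drawingD(1)[OF d] and wf = pair_graphD(3-6)[OF G]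
  define a where "a = p x"
  obtain R where R: "R > 0" "cball a R \<inter> p ` pverts G = {a}"
    and away: "\<And>u v. (u, v) \<in> parcs G \<Longrightarrow> x \<notin> {u, v} \<Longrightarrow> cball a R \<inter> path_image (c {u, v}) = {}"
    using ball_avoiding_rest[OF d G x] unfolding a_def by metis
  define N where "N = {y. (x, y) \<in> parcs G}"
  have Nx: "y \<noteq> x" "y \<in> pverts G" if "y \<in> N" for y
    using that wf unfolding N_def by blast+
  have far: "dist a (p y) > R" if "y \<in> pverts G" "y \<noteq> x" for y
  proof (rule ccontr)
    assume "\<not> dist a (p y) > R"
    then have "p y \<in> cball a R \<inter> p ` pverts G"
      using that(1) by simp
    then have "p y = p x"
      unfolding R(2) by (simp add: a_def)
    then show False
      using inj x that by (meson inj_onD)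
  qed
  have "\<exists>h. arc h \<and> pathstart h = p y \<and> path_image h \<subseteq> path_image (c {x, y}) \<and>
      path_image h \<inter> cball a R = {pathfinish h} \<and> dist a (pathfinish h) = R" if "y \<in> N" for y
  proof -
    have xy: "(x, y) \<in> parcs G"
      using that N_def by simp
    \<comment> \<open>The arc of an edge may run in either direction; it is reversed if necessary so
      as to start at \<open>y\<close>.\<close>
    have "\<exists>g. arc g \<and> pathstart g = p y \<and> pathfinish g = a \<and> path_image g = path_image (c {x, y})"
    proof (cases "pathstart (c {x, y}) = p y")
      case True
      then have "pathfinish (c {x, y}) = a"
        using plane_drawingD(3)[OF d xy] unfolding a_def by (auto simp: doubleton_eq_iff)
      then show ?thesis
        using True plane_drawingD(2)[OF d xy] by blast
    next
      case False
      then have "pathstart (c {x, y}) = a" "pathfinish (c {x, y}) = p y"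
        using plane_drawingD(3)[OF d xy] unfolding a_def by (auto simp: doubleton_eq_iff)
      then show ?thesis
        using arc_reversepath[OF plane_drawingD(2)[OF d xy]]
        by (intro exI[of _ "reversepath (c {x, y})"]) auto
    qed
    then obtain g where g: "arc g" "pathstart g = p y" "pathfinish g = a"
      "path_image g = path_image (c {x, y})" by blast
    show ?thesis
      using arc_initial_segment_outside_ball[OF g(1,3) R(1)] far[OF Nx(2,1)[OF that]] g(2,4) by metis
  qed
  then obtain h where h: "\<And>y. y \<in> N \<Longrightarrow> arc (h y)" "\<And>y. y \<in> N \<Longrightarrow> pathstart (h y) = p y"
    "\<And>y. y \<in> N \<Longrightarrow> path_image (h y) \<subseteq> path_image (c {x, y})"
    "\<And>y. y \<in> N \<Longrightarrow> path_image (h y) \<inter> cball a R = {pathfinish (h y)}"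
    "\<And>y. y \<in> N \<Longrightarrow> dist a (pathfinish (h y)) = R"
    by metis
  \<comment> \<open>\<open>z y\<close> is the point where the edge, coming from \<open>y\<close>,
    first reaches the disc.\<close>
  define z where "z y = pathfinish (h y)" for y
  have zR: "dist a (z y) = R" if "y \<in> N" for y
    using h(5)[OF that] by (simp add: z_def)
  have hz: "path_image (h y) \<inter> cball a R = {z y}" if "y \<in> N" for y
    using h(4)[OF that] by (simp add: z_def)
  have za: "z y \<noteq> a" if "y \<in> N" for y
    using zR[OF that] R(1) by auto
  have seg: "closed_segment a w \<subseteq> cball a R" if "dist a w = R" for w
    using that R(1) by (intro closed_segment_subset) auto
  have segV: "closed_segment a (z y) \<inter> p ` pverts G = {a}" if "y \<in> N" for y
    using seg[OF zR[OF that]] R(2) by auto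
  have ah: "a \<notin> path_image (h y)" if "y \<in> N" for y
  proof
    assume "a \<in> path_image (h y)"
    then have "a \<in> path_image (h y) \<inter> cball a R"
      using R(1) by simp
    then show False
      using hz[OF that] za[OF that] by simp
  qed
  \<comment> \<open>The full edges meet only in the centre \<open>a\<close>, which the truncated
    arcs avoid.\<close>
  have hh: "path_image (h y) \<inter> path_image (h y') = {}" if "y \<in> N" "y' \<in> N" "y \<noteq> y'" for y y'
  proof -
    have "path_image (c {x, y}) \<inter> path_image (c {x, y'}) \<subseteq> p ` ({x, y} \<inter> {x, y'})"
      by (rule plane_drawingD(5)[OF d])
        (use that N_def Nx(1) in \<open>auto simp: doubleton_eq_iff\<close>)
    also have "\<dots> = {a}"
      using that Nx unfolding a_def by auto
    finally show ?thesis
      using h(3)[OF that(1)] h(3)[OF that(2)] ah[OF that(1)] by blast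
  qed
  have zz: "z y \<noteq> z y'" if "y \<in> N" "y' \<in> N" "y \<noteq> y'" for y y'
    using hh[OF that] hz that by blast
  have hseg: "path_image (h y) \<inter> closed_segment a w \<subseteq> {z y}" if "y \<in> N" "dist a w = R" for y w
    using hz[OF that(1)] seg[OF that(2)] by auto
  \<comment> \<open>Arcs are indexed by edges as sets, so for an edge \<open>e\<close> at
    \<open>x\<close> the other end is recovered as the only element of
    \<open>e - {x}\<close>.\<close>
  define c' where "c' e = (if x \<in> e then h (the_elem (e - {x})) +++ linepath (z (the_elem (e - {x}))) a
      else c e)" for e
  have c'x: "c' {x, y} = h y +++ linepath (z y) a" if "y \<in> N" for y
  proof -
    have "{x, y} - {x} = {y}"
      using Nx[OF that] by auto
    then show ?thesis
      by (simp add: c'_def)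
  qed
  have c'x_im: "path_image (c' {x, y}) = path_image (h y) \<union> closed_segment a (z y)" if "y \<in> N" for y
    using c'x[OF that] by (simp add: path_image_join z_def closed_segment_commute)
  have c'o: "c' {u, v} = c {u, v}" if "x \<notin> {u, v}" for u v
    using that by (simp add: c'_def)
  have incident: "\<exists>y \<in> N. {u, v} = {x, y}" if "(u, v) \<in> parcs G" "x \<in> {u, v}" for u v
  proof (cases "x = u")
    case True
    then show ?thesis
      using that(1) N_def by blast
  next
    case False
    then have "u \<in> N" "{u, v} = {x, u}"
      using that wf(4)[OF that(1)] N_def by auto
    then show ?thesis by blast
  qed
  have c'x_arc: "arc (c' {x, y})"
    "{pathstart (c' {x, y}), pathfinish (c' {x, y})} = {p x, p y}"
    "path_image (c' {x, y}) \<inter> p ` pverts G = {p x, p y}" if y: "y \<in> N" for y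
  proof -
    have xy: "(x, y) \<in> parcs G"
      using y N_def by simp
    show "arc (c' {x, y})"
      unfolding c'x[OF y]
      using hseg[OF y zR[OF y]] za[OF y] h(1)[OF y]
      by (intro arc_join) (auto simp: z_def closed_segment_commute)
    show "{pathstart (c' {x, y}), pathfinish (c' {x, y})} = {p x, p y}"
      unfolding c'x[OF y] using h(2)[OF y] by (auto simp: a_def)
    have "p y \<in> path_image (h y)"
      using h(2)[OF y] by (metis pathstart_in_path_image)
    moreover have "path_image (h y) \<inter> p ` pverts G \<subseteq> {p x, p y}"
      using plane_drawingD(4)[OF d xy] h(3)[OF y] by blast
    ultimately show "path_image (c' {x, y}) \<inter> p ` pverts G = {p x, p y}"
      using segV[OF y] Nx(2)[OF y] unfolding c'x_im[OF y] a_def by blast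
  qed
  have xx: "path_image (c' {x, y}) \<inter> path_image (c' {x, y'}) \<subseteq> {a}"
    if "y \<in> N" "y' \<in> N" "y \<noteq> y'" for y y'
  proof -
    have rr: "closed_segment a (z y) \<inter> closed_segment a (z y') = {a}"
      by (rule radii_meet_at_centre) (use zR that zz R(1) in auto)
    \<comment> \<open>The truncated arc could meet the other radius only in \<open>z y\<close>. That
      point is on its own radius and is not the centre, hence not on a different radius.\<close>
    have "path_image (h y) \<inter> closed_segment a (z y') = {}"
      if yy: "y \<in> N" "y' \<in> N" "y \<noteq> y'" for y y'
    proof -
      have "z y \<notin> closed_segment a (z y')"
      proof
        assume "z y \<in> closed_segment a (z y')"
        then have "z y \<in> closed_segment a (z y) \<inter> closed_segment a (z y')"
          by simp
        also have "\<dots> = {a}"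
          by (rule radii_meet_at_centre) (use zR yy zz R(1) in auto)
        finally show False
          using za[OF yy(1)] by simp
      qed
      then show ?thesis
        using hseg[OF yy(1) zR[OF yy(2)]] by auto
    qed
    from this[OF that] this[OF that(2,1) that(3)[symmetric]]
    show ?thesis
      unfolding c'x_im[OF that(1)] c'x_im[OF that(2)] using hh[OF that] rr by blast
  qed
  have xo: "path_image (c' {x, y}) \<inter> path_image (c' {u, v}) \<subseteq> p ` ({x, y} \<inter> {u, v})"
    if y: "y \<in> N" and uv: "(u, v) \<in> parcs G" "x \<notin> {u, v}" for y u v
  proof -
    have "path_image (c {x, y}) \<inter> path_image (c {u, v}) \<subseteq> p ` ({x, y} \<inter> {u, v})"
      by (rule plane_drawingD(5)[OF d _ uv(1)]) (use y uv N_def in auto)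
    \<comment> \<open>Outside the disc the old arcs are kept; inside it there is no edge that avoids
      \<open>x\<close>.\<close>
    then show ?thesis
      using h(3)[OF y] away[OF uv] seg[OF zR[OF y]] unfolding c'x_im[OF y] c'o[OF uv(2)] by blast
  qed
  have d': "plane_drawing G p c'"
  proof (rule plane_drawingI)
    show "inj_on p (pverts G)" by (rule inj)
  next
    fix u v assume uv: "(u, v) \<in> parcs G"
    have "arc (c' {u, v}) \<and> {pathstart (c' {u, v}), pathfinish (c' {u, v})} = p ` {u, v} \<and>
        path_image (c' {u, v}) \<inter> p ` pverts G = p ` {u, v}"
    proof (cases "x \<in> {u, v}")
      case True
      then obtain y where "y \<in> N" "{u, v} = {x, y}"
        using incident[OF uv] by blast
      then show ?thesis
        using c'x_arc by simp
    next
      case False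
      then show ?thesis
        using plane_drawingD(2-4)[OF d uv] c'o by simp
    qed
    then show "arc (c' {u, v})" "{pathstart (c' {u, v}), pathfinish (c' {u, v})} = {p u, p v}"
      "path_image (c' {u, v}) \<inter> p ` pverts G = {p u, p v}"
      by simp_all
  next
    fix u v s t assume *: "(u, v) \<in> parcs G" "(s, t) \<in> parcs G" "{u, v} \<noteq> {s, t}"
    show "path_image (c' {u, v}) \<inter> path_image (c' {s, t}) \<subseteq> p ` ({u, v} \<inter> {s, t})"
    proof (cases "x \<in> {u, v}"; cases "x \<in> {s, t}")
      assume "x \<in> {u, v}" "x \<in> {s, t}"
      then obtain y y' where y: "y \<in> N" "{u, v} = {x, y}" "y' \<in> N" "{s, t} = {x, y'}"
        using incident * by metis
      then have "y \<noteq> y'"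
        using * by auto
      then show ?thesis
        using xx[OF y(1,3)] unfolding y a_def by blast
    next
      assume "x \<in> {u, v}" "x \<notin> {s, t}"
      then show ?thesis
        using incident[OF *(1)] xo[OF _ *(2)] by metis
    next
      assume "x \<notin> {u, v}" "x \<in> {s, t}"
      then show ?thesis
        using incident[OF *(2)] xo[OF _ *(1)] by (metis Int_commute)
    next
      assume "x \<notin> {u, v}" "x \<notin> {s, t}"
      then show ?thesis
        using plane_drawingD(5)[OF d *] c'o by metis
    qed
  qed
  have "finite N"
    using pair_graphD(1)[OF G] Nx by (meson finite_subset subsetI)
  then have "finite (z ` N)" by simp
  \<comment> \<open>A finite connected set has at most one point, but the circle contains two
    antipodal points.\<close>
  moreover have "infinite (sphere a R)"
  proof
    assume "finite (sphere a R)"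
    then have "sphere a R = {} \<or> (\<exists>w. sphere a R = {w})"
      using connected_finite_iff_sing connected_sphere[of a R] by (metis DIM_complex order_refl)
    moreover have "a + of_real R \<in> sphere a R" "a - of_real R \<in> sphere a R"
      using R(1) by (simp_all add: dist_norm)
    ultimately have "a + of_real R = a - of_real R"
      by fastforce
    then show False
      using R(1) by (simp add: eq_diff_eq)
  qed
  ultimately obtain q where q: "q \<in> sphere a R" "q \<notin> z ` N"
    by (meson finite_subset subsetI)
  then have qR: "dist a q = R" by simp
  have "closed_segment a q \<inter> drawing_points G p c' \<subseteq> {a}"
  proof
    fix w assume w: "w \<in> closed_segment a q \<inter> drawing_points G p c'"
    then have wR: "w \<in> cball a R"
      using seg[OF qR] by blast
    from w have "w \<in> drawing_points G p c'" by simp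
    then show "w \<in> {a}"
    proof (cases rule: drawing_pointsE)
      case (1 v)
      then show ?thesis
        using R(2) wR by blast
    next
      case (2 u v)
      show ?thesis
      proof (cases "x \<in> {u, v}")
        case True
        then obtain y where y: "y \<in> N" "{u, v} = {x, y}"
          using incident 2 by blast
        have eq: "closed_segment a (z y) \<inter> closed_segment a q = {a}"
          by (rule radii_meet_at_centre) (use zR y qR q R(1) in auto)
        \<comment> \<open>The truncated arc touches the disc only in \<open>z y\<close>, which is on
          the radius as well.\<close>
        have "w \<in> closed_segment a (z y)"
        proof (cases "w \<in> path_image (h y)")
          case True
          then have "w \<in> path_image (h y) \<inter> cball a R"
            using wR by (rule IntI)
          then show ?thesis
            unfolding hz[OF y(1)] by simp
        next
          case False
          then show ?thesis
            using 2(2) unfolding y c'x_im[OF y(1)] by blast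
        qed
        then show ?thesis
          using eq w by blast
      next
        case False
        then show ?thesis
          using away[OF 2(1)] 2(2) c'o wR by auto
      qed
    qed
  qed
  moreover have "q \<noteq> a"
    using qR R(1) by auto
  ultimately show thesis
    unfolding a_def by (intro that[OF d'])
qed

section \<open>Opening a slit plane to a half plane\<close>

text \<open>The point \<open>0\<close>, the future image of the root vertex, lies on the branch cut.
  Continuity there comes from \<open>norm (csqrt z) = sqrt (norm z)\<close>.\<close>

lemma continuous_on_csqrt_slit: "continuous_on (insert 0 (- \<real>\<^sub>\<le>\<^sub>0)) csqrt"
proof (clarsimp simp: continuous_on_eq_continuous_within, intro conjI ballI)
  have "((\<lambda>z. z) \<longlongrightarrow> 0) (at (0 :: complex) within insert 0 (- \<real>\<^sub>\<le>\<^sub>0))"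
    by (rule tendsto_ident_at)
  from tendsto_real_sqrt[OF tendsto_norm[OF this]]
  have "((\<lambda>z. norm (csqrt z)) \<longlongrightarrow> 0) (at 0 within insert 0 (- \<real>\<^sub>\<le>\<^sub>0))"
    by simp
  then show "continuous (at 0 within insert 0 (- \<real>\<^sub>\<le>\<^sub>0)) csqrt"
    unfolding continuous_within csqrt_0 by (rule tendsto_norm_zero_cancel)
next
  fix z :: complex assume "z \<in> - \<real>\<^sub>\<le>\<^sub>0"
  then show "continuous (at z within insert 0 (- \<real>\<^sub>\<le>\<^sub>0)) csqrt"
    by (simp add: continuous_within_csqrt)
qed

lemma planar_rooted_half_plane:
  assumes "planar G" and G: "pair_graph G" and x: "x \<in> pverts G"
  obtains p c where "plane_drawing G p c" "p x = 0"
    "drawing_points G p c \<subseteq> insert 0 {z. Re z > 0}"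
proof -
  obtain p c q where d: "plane_drawing G p c" and q: "q \<noteq> p x"
    "closed_segment (p x) q \<inter> drawing_points G p c \<subseteq> {p x}"
    using planar_free_segment[OF assms] .
  define a where "a = p x"
  \<comment> \<open>\<open>S\<close> keeps \<open>a\<close> but omits \<open>q\<close>, the pole of
    the Moebius map \<open>m\<close>.\<close>
  define S where "S = insert a (- closed_segment a q)"
  define m where "m z = (z - a) / (z - q)" for z
  have qS: "z \<noteq> q" if "z \<in> S" for z
    using that q(1) unfolding S_def a_def by auto
  \<comment> \<open>Solving \<open>m z = r\<close> with \<open>r \<le> 0\<close> exhibits
    \<open>z\<close> as a convex combination of \<open>a\<close> and \<open>q\<close>; within
    \<open>S\<close> this leaves \<open>z = a\<close>, where \<open>m\<close> vanishes.\<close>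
  have m0: "m z \<in> insert 0 (- \<real>\<^sub>\<le>\<^sub>0)" if z: "z \<in> S" for z
  proof (rule ccontr)
    assume *: "\<not> m z \<in> insert 0 (- \<real>\<^sub>\<le>\<^sub>0)"
    then have "m z \<in> \<real>\<^sub>\<le>\<^sub>0" "m z \<noteq> 0" by auto
    then obtain r where r: "m z = complex_of_real r" "r \<le> 0"
      by (auto elim: nonpos_Reals_cases)
    have "z - a = of_real r * (z - q)"
      using r(1) qS[OF z] unfolding m_def by (simp add: field_simps)
    then have e: "of_real (1 - r) * z = a - of_real r * q"
      by (simp add: algebra_simps)
    have "of_real (1 - r) \<noteq> (0 :: complex)"
      using r(2) by (simp only: of_real_eq_0_iff)
    then have "z = (a - of_real r * q) / of_real (1 - r)"
      using e by (simp add: field_simps)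
    also have "\<dots> = (1 - (- r / (1 - r))) *\<^sub>R a + (- r / (1 - r)) *\<^sub>R q"
    proof -
      have "1 - (- r / (1 - r)) = 1 / (1 - r)"
        using r(2) by (simp add: field_simps)
      then show ?thesis
        by (simp only:) (simp add: scaleR_conv_of_real diff_divide_distrib)
    qed
    finally have "z = (1 - (- r / (1 - r))) *\<^sub>R a + (- r / (1 - r)) *\<^sub>R q" .
    moreover have "0 \<le> - r / (1 - r)" "- r / (1 - r) \<le> 1"
      using r(2) by (simp_all add: divide_simps)
    ultimately have "z \<in> closed_segment a q"
      unfolding in_segment by blast
    then have "z = a"
      using z unfolding S_def by auto
    then show False
      using \<open>m z \<noteq> 0\<close> by (simp add: m_def)
  qed
  have "continuous_on S m"
    unfolding m_def using qS by (intro continuous_intros) auto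
  then have cont: "continuous_on S (\<lambda>z. csqrt (m z))"
    using continuous_on_compose2[OF continuous_on_csqrt_slit] m0 by (metis image_subsetI)
  have inj: "inj_on (\<lambda>z. csqrt (m z)) S"
  proof (rule inj_onI)
    fix z w assume zw: "z \<in> S" "w \<in> S" "csqrt (m z) = csqrt (m w)"
    then have "m z = m w"
      by (metis power2_csqrt)
    \<comment> \<open>Cross-multiplication leaves the nonzero determinant \<open>a - q\<close> of
      \<open>m\<close> as a factor.\<close>
    then have "(z - w) * (a - q) = 0"
      using qS zw(1,2) unfolding m_def by (simp add: field_simps)
    then show "z = w"
      using q(1) unfolding a_def by simp
  qed
  have sub: "drawing_points G p c \<subseteq> S"
    using q(2) unfolding S_def a_def by blast
  note d' = plane_drawing_image[OF d G cont inj sub]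
  have "csqrt (m z) \<in> insert 0 {z. Re z > 0}" if "z \<in> S" for z
  proof (cases "m z = 0")
    case False
    then have "m z \<notin> \<real>\<^sub>\<le>\<^sub>0"
      using m0[OF that] by simp
    \<comment> \<open>A number with real part zero has a nonpositive real square.\<close>
    then have "Re (csqrt (m z)) \<noteq> 0"
      by (metis Re_csqrt Re_power2 complex_nonpos_Reals_iff Im_power2 mult_zero_left mult_zero_right 
          diff_0 neg_le_0_iff_le power2_csqrt zero_le_power2 zero_power2)
    then show ?thesis
      using Re_csqrt[of "m z"] by simp
  qed simp
  then have "(\<lambda>z. csqrt (m z)) ` drawing_points G p c \<subseteq> insert 0 {z. Re z > 0}"
    using sub by blast
  moreover have "((\<lambda>z. csqrt (m z)) \<circ> p) x = 0"
    by (simp add: m_def a_def)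
  ultimately show thesis
    using that[OF d'(1)] unfolding d'(2) by blast
qed

section \<open>Gluing planar graphs at a vertex\<close>

text \<open>Both drawings place \<open>x\<close> at \<open>0\<close>, which \<open>uminus\<close>
  fixes while moving the rest of the second drawing to the left half plane.\<close>

lemma planar_one_sum:
  assumes "planar G1" "planar G2" and G1: "pair_graph G1" and G2: "pair_graph G2"
    and verts: "pverts G = pverts G1 \<union> pverts G2" and arcs: "parcs G = parcs G1 \<union> parcs G2"
    and x: "pverts G1 \<inter> pverts G2 = {x}"
  shows "planar G"
proof -
  have x': "x \<in> pverts G1" "x \<in> pverts G2"
    using x by auto
  obtain p1 c1 where d1: "plane_drawing G1 p1 c1" "p1 x = 0"
    "drawing_points G1 p1 c1 \<subseteq> insert 0 {z. Re z > 0}"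
    using planar_rooted_half_plane[OF assms(1) G1 x'(1)] .
  obtain p2 c2 where d2: "plane_drawing G2 p2 c2" "p2 x = 0"
    "drawing_points G2 p2 c2 \<subseteq> insert 0 {z. Re z > 0}"
    using planar_rooted_half_plane[OF assms(2) G2 x'(2)] .
  have f: "continuous_on UNIV (uminus :: complex \<Rightarrow> complex)" "inj_on (uminus :: complex \<Rightarrow> complex) UNIV"
    by (auto intro: continuous_intros)
  note d2' = plane_drawing_image[OF d2(1) G2 f subset_UNIV]
  have "Re z < 0 \<or> z = 0" if "z \<in> drawing_points G2 (uminus \<circ> p2) (\<lambda>e. uminus \<circ> c2 e)" for z
    using that d2(3) unfolding d2'(2) by auto
  then have "drawing_points G1 p1 c1 \<inter> drawing_points G2 (uminus \<circ> p2) (\<lambda>e. uminus \<circ> c2 e) \<subseteq> {0}"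
    using d1(3) less_asym by blast
  then show ?thesis
    by (intro planar_union[OF d1(1) d2'(1) G1 G2 verts arcs, of x]) (auto simp: x d1(2) d2(2))
qed

lemma planar_single_vertex:
  assumes "pair_graph G" "pverts G = {v}"
  shows "planar G"
proof -
  have "parcs G = {}"
    using pair_graphD(3,4,5)[OF assms(1)] assms(2) by (metis prod.collapse singletonD equals0I)
  then have "plane_drawing G (\<lambda>_. 0) c" for c
    unfolding plane_drawing_def assms(2) by simp
  then show ?thesis
    unfolding planar_def by blast
qed

section \<open>Vertex deletion, connectedness and separations\<close>

lemma delete_verts_simps [simp]:
  "pverts (delete_verts G S) = pverts G - S"
  "(u, v) \<in> parcs (delete_verts G S) \<longleftrightarrow> (u, v) \<in> parcs G \<and> u \<notin> S \<and> v \<notin> S"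
  unfolding delete_verts_def by auto

lemma pair_graph_delete_verts: "pair_graph G \<Longrightarrow> pair_graph (delete_verts G S)"
  unfolding pair_graph_iff by auto

text \<open>Connectedness is defined through the symmetric closure, which adds no arcs to a
  symmetric graph.\<close>

lemma reachable_symmetric_iff:
  assumes "pair_graph G"
  shows "reachable (with_proj (mk_symmetric (with_proj G))) u v \<longleftrightarrow>
    (u, v) \<in> rtrancl_on (pverts G) (parcs G)"
proof -
  have "parcs (mk_symmetric (with_proj G)) = parcs G"
    using pair_graphD(6)[OF assms] by (auto simp: mk_symmetric_def)
  moreover have "pverts (mk_symmetric (with_proj G)) = pverts G"
    by (simp add: mk_symmetric_def)
  ultimately show ?thesis
    by (simp add: reachable_def)
qed

lemma connected_iff:
  assumes "pair_graph G"
  shows "Digraph_Component.connected (with_proj G) \<longleftrightarrow> pverts G \<noteq> {} \<and>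
    (\<forall>u \<in> pverts G. \<forall>v \<in> pverts G. (u, v) \<in> rtrancl_on (pverts G) (parcs G))"
  unfolding Digraph_Component.connected_def strongly_connected_def
    reachable_symmetric_iff[OF assms]
  by (simp add: mk_symmetric_def)

text \<open>If no arc left \<open>A\<close>, induction along a walk from \<open>a\<close> would put
  \<open>b\<close> into \<open>A\<close>.\<close>

lemma connected_arc_leaving:
  assumes "pair_graph G" "Digraph_Component.connected (with_proj G)"
    and "A \<subseteq> pverts G" "a \<in> A" "b \<in> pverts G - A"
  obtains u v where "(u, v) \<in> parcs G" "u \<in> A" "v \<notin> A"
proof -
  have "(a, b) \<in> rtrancl_on (pverts G) (parcs G)"
    using assms unfolding connected_iff[OF assms(1)] by blast
  then have "b \<in> A" if "\<And>u v. (u, v) \<in> parcs G \<Longrightarrow> u \<in> A \<Longrightarrow> v \<in> A"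
    by (induction rule: rtrancl_on_induct) (use assms(4) that in auto)
  then show thesis
    using assms(5) that by blast
qed

text \<open>\<open>A\<close> consists of the vertices reachable from some \<open>a\<close> that does
  not reach every vertex; symmetry of the arcs gives both directions of the last claim.\<close>

lemma disconnected_partition:
  assumes G: "pair_graph G" and "\<not> Digraph_Component.connected (with_proj G)" "pverts G \<noteq> {}"
  obtains A B where "A \<noteq> {}" "B \<noteq> {}" "A \<inter> B = {}" "A \<union> B = pverts G"
    "\<And>u v. (u, v) \<in> parcs G \<Longrightarrow> u \<in> A \<longleftrightarrow> v \<in> A"
proof -
  obtain a b where ab: "a \<in> pverts G" "b \<in> pverts G" "(a, b) \<notin> rtrancl_on (pverts G) (parcs G)"
    using assms unfolding connected_iff[OF G] by blast
  define A where "A = {v. (a, v) \<in> rtrancl_on (pverts G) (parcs G)}"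
  have closed: "v \<in> A" if "(u, v) \<in> parcs G" "u \<in> A" for u v
    using that pair_graphD(4)[OF G that(1)] unfolding A_def
    by (auto intro: rtrancl_on_into_rtrancl_on)
  show thesis
  proof (rule that[of A "pverts G - A"])
    show "A \<noteq> {}" "pverts G - A \<noteq> {}"
      using ab by (auto simp: A_def)
    show "A \<union> (pverts G - A) = pverts G"
      by (auto simp: A_def dest: in_rtrancl_on_in_F)
    show "u \<in> A \<longleftrightarrow> v \<in> A" if "(u, v) \<in> parcs G" for u v
      using closed that pair_graphD(6)[OF G that] by blast
  qed auto
qed

section \<open>Minimality applied at a cut vertex\<close>

text \<open>A subgraph other than \<open>G\<close> is a proper minor, so by minimality some vertex
  deletion makes it planar.\<close>

lemma MMNA_subgraph:
  assumes "MMNA G" "pair_graph H" "pverts H \<noteq> {}" "pverts H \<subseteq> pverts G" "parcs H \<subseteq> parcs G"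
    and "H \<noteq> G"
  obtains v where "v \<in> pverts H" "planar (delete_verts H {v})"
proof -
  have G: "pair_graph G"
    using assms(1) by (simp add: MMNA_def not_apex_def simple_graph_def)
  have "wf_digraph (with_proj K)" if "pair_graph K" for K :: "'a pair_pre_digraph"
    using pair_graphD(3,4)[OF that] by unfold_locales auto
  then have "subgraph (with_proj H) (with_proj G)"
    using assms(2,4,5) G by (simp add: subgraph_def compatible_def)
  moreover have H: "simple_graph H"
    using assms(2,3) by (simp add: simple_graph_def)
  ultimately have "proper_minor G H"
    using assms(6) unfolding proper_minor_def by (blast intro: minor.subgraph)
  then have "\<not> not_apex H"
    using assms(1) by (simp add: MMNA_def)
  then show thesis
    using that H unfolding not_apex_def by blast
qed

text \<open>The graph claimed to be planar is the one induced on \<open>A\<close>. The edge from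
  \<open>a\<close> to \<open>x\<close> ensures that cutting \<open>A\<close> off from
  \<open>x\<close> yields a proper subgraph.\<close>

lemma MMNA_cut_side_planar:
  assumes M: "MMNA G" and V: "pverts G = insert x (A \<union> B)"
    and AB: "x \<notin> A" "x \<notin> B" "A \<inter> B = {}" "A \<noteq> {}" "B \<noteq> {}"
    and sep: "\<And>u v. (u, v) \<in> parcs G \<Longrightarrow> \<not> (u \<in> A \<and> v \<in> B)"
    and xA: "(a, x) \<in> parcs G" "a \<in> A"
  shows "planar (delete_verts G (insert x B))"
proof (rule ccontr)
  assume nonplanar: "\<not> planar (delete_verts G (insert x B))"
  have G: "pair_graph G" and NA: "\<And>v. v \<in> pverts G \<Longrightarrow> \<not> planar (delete_verts G {v})"
    using M by (auto simp: MMNA_def not_apex_def simple_graph_def)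
  note wf = pair_graphD(3-6)[OF G]
  have sep': "\<not> (u \<in> B \<and> v \<in> A)" if "(u, v) \<in> parcs G" for u v
    using sep wf(4)[OF that] by blast
  \<comment> \<open>As no arc joins \<open>A\<close> and \<open>B\<close>, exactly the edges between
    \<open>x\<close> and \<open>A\<close> are removed.\<close>
  define H where "H = \<lparr>pverts = pverts G, parcs = {(u, v) \<in> parcs G. u \<in> A \<longleftrightarrow> v \<in> A}\<rparr>"
  have H: "pair_graph H" "pverts H = pverts G"
    "\<And>u v. (u, v) \<in> parcs H \<longleftrightarrow> (u, v) \<in> parcs G \<and> (u \<in> A \<longleftrightarrow> v \<in> A)"
    using G unfolding pair_graph_iff H_def by auto
  have "H \<noteq> G"
    using H(3)[of a x] xA AB(1) by auto
  moreover have "parcs H \<subseteq> parcs G"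
    using H(3) by auto
  ultimately obtain v where v: "v \<in> pverts H" "planar (delete_verts H {v})"
    using MMNA_subgraph[OF M H(1)] H(2) V by (metis insert_not_empty order_refl)
  \<comment> \<open>Otherwise, even for \<open>v = x\<close>, the graph on \<open>A\<close> survives
    in \<open>H - v\<close> and would be planar.\<close>
  have "v \<in> A"
  proof (rule ccontr)
    assume "v \<notin> A"
    have "parcs (delete_verts G (insert x B)) \<subseteq> parcs (delete_verts H {v})"
    proof (rule subrelI)
      fix a b assume "(a, b) \<in> parcs (delete_verts G (insert x B))"
      then have ab: "(a, b) \<in> parcs G" "a \<notin> insert x B" "b \<notin> insert x B"
        by auto
      then have "a \<in> A" "b \<in> A"
        using wf(1)[OF ab(1)] wf(2)[OF ab(1)] V by auto
      then show "(a, b) \<in> parcs (delete_verts H {v})"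
        using ab(1) H(3) \<open>v \<notin> A\<close> by auto
    qed
    then have "planar (delete_verts G (insert x B))"
      by (intro planar_mono[OF v(2) pair_graph_delete_verts[OF G]])
        (use H(2) V \<open>v \<notin> A\<close> in auto)
    then show False
      using nonplanar by blast
  qed
  \<comment> \<open>With \<open>v\<close> in \<open>A\<close>, all of the graph on
    \<open>insert x B\<close> survives in \<open>H - v\<close>.\<close>
  have planar_B: "planar (delete_verts G A)"
    by (rule planar_mono[OF v(2) pair_graph_delete_verts[OF G]])
      (use H V \<open>v \<in> A\<close> in auto)
  \<comment> \<open>Minimality is now applied a second time, to the graph on
    \<open>insert x A\<close>.\<close>
  have "delete_verts G B \<noteq> G"
    using V AB(5) by (metis Diff_disjoint delete_verts_simps(1) inf.absorb_iff2 inf_commute le_supI2 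
        subset_insertI2 sup_ge2)
  moreover have "parcs (delete_verts G B) \<subseteq> parcs G"
    by auto
  ultimately obtain w where w: "w \<in> pverts (delete_verts G B)"
    "planar (delete_verts (delete_verts G B) {w})"
    using MMNA_subgraph[OF M pair_graph_delete_verts[OF G], of B] V AB(2)
    by (metis Diff_subset delete_verts_simps(1) Diff_iff empty_iff insertI1)
  \<comment> \<open>Removing \<open>x\<close> from this subgraph leaves just the graph on
    \<open>A\<close>, assumed nonplanar.\<close>
  have "w \<noteq> x"
  proof
    assume "w = x"
    have "planar (delete_verts G (insert x B))"
      by (rule planar_mono[OF w(2) pair_graph_delete_verts[OF G]]) (auto simp: \<open>w = x\<close>)
    then show False
      using nonplanar by blast
  qed
  then have "w \<in> A"
    using w(1) V by auto
  have "planar (delete_verts G {w})"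
  proof (rule planar_one_sum[OF w(2) planar_B])
    show "pverts (delete_verts G {w}) = pverts (delete_verts (delete_verts G B) {w}) \<union> pverts (delete_verts G A)"
      "pverts (delete_verts (delete_verts G B) {w}) \<inter> pverts (delete_verts G A) = {x}"
      using V AB \<open>w \<in> A\<close> by auto
    show "parcs (delete_verts G {w}) = parcs (delete_verts (delete_verts G B) {w}) \<union> parcs (delete_verts G A)"
      using V AB \<open>w \<in> A\<close> wf(1,2) sep sep' by auto
  qed (simp_all add: pair_graph_delete_verts G)
  then show False
    using NA w(1) by simp
qed

section \<open>Graphs of connectivity one\<close>

text \<open>\<open>P 2\<close> can fail because of a cut with fewer than two vertices or because
  there are too few vertices. The latter case is the complete graph on two vertices, which has no
  cut vertex.\<close>

lemma connectivity_eq_1: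
  assumes G: "pair_graph G" and ne: "pverts G \<noteq> {}" and c: "connectivity G = 1"
  shows "Digraph_Component.connected (with_proj G)"
    and "card (pverts G) = 2 \<or>
      (\<exists>x \<in> pverts G. pverts G \<noteq> {x} \<and>
        \<not> Digraph_Component.connected (with_proj (delete_verts G {x})))"
proof -
  define P where "P k \<longleftrightarrow> k < card (pverts G) \<and> (\<forall>l < k. \<not> (\<exists>S. is_cut G l S))" for k
  have conn: "connectivity G = (GREATEST k. P k)"
    by (simp add: connectivity_def P_def)
  \<comment> \<open>This bound ensures that the \<open>GREATEST\<close> in the definition is
    attained.\<close>
  have bound: "k \<le> card (pverts G)" if "P k" for k
    using that by (simp add: P_def)
  have "P 0"
    using pair_graphD(1)[OF G] ne by (simp add: P_def card_gt_0_iff)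
  then have "P 1"
    using GreatestI_nat[of P] bound conn c by metis
  have "\<not> P 2"
    using Greatest_le_nat[of P 2, OF _ bound] conn c by auto
  have "delete_verts G {} = G"
    by (simp add: delete_verts_def)
  moreover have "{} \<subset> pverts G"
    using \<open>P 1\<close> by (auto simp: P_def)
  moreover have "\<not> is_cut G 0 {}"
    using \<open>P 1\<close> by (auto simp: P_def)
  ultimately show "Digraph_Component.connected (with_proj G)"
    by (simp add: is_cut_def)
  show "card (pverts G) = 2 \<or> (\<exists>x \<in> pverts G. pverts G \<noteq> {x} \<and>
      \<not> Digraph_Component.connected (with_proj (delete_verts G {x})))"
  proof (rule disjCI)
    assume no_cut: "\<not> (\<exists>x \<in> pverts G. pverts G \<noteq> {x} \<and>
      \<not> Digraph_Component.connected (with_proj (delete_verts G {x})))"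
    have "\<not> is_cut G 1 S" for S
      using no_cut by (auto simp: is_cut_def card_1_singleton_iff)
    moreover have "\<not> is_cut G 0 S" for S
      using \<open>P 1\<close> by (auto simp: P_def)
    ultimately have "\<not> (\<exists>S. is_cut G l S)" if "l < 2" for l
      using that by (auto simp: less_2_cases_iff)
    then have "card (pverts G) \<le> 2"
      using \<open>\<not> P 2\<close> by (auto simp: P_def)
    then show "card (pverts G) = 2"
      using \<open>P 1\<close> by (simp add: P_def)
  qed
qed

theorem theorem4p3:
  shows "\<not> (\<exists>G :: 'a pair_pre_digraph. MMNA G \<and> connectivity G = 1)"
proof
  assume "\<exists>G :: 'a pair_pre_digraph. MMNA G \<and> connectivity G = 1"
  then obtain G :: "'a pair_pre_digraph" where M: "MMNA G" and c: "connectivity G = 1"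
    by blast
  then have G: "pair_graph G" and ne: "pverts G \<noteq> {}"
    and NA: "\<And>v. v \<in> pverts G \<Longrightarrow> \<not> planar (delete_verts G {v})"
    by (auto simp: MMNA_def not_apex_def simple_graph_def)
  note wf = pair_graphD(3-6)[OF G]
  \<comment> \<open>In the case without a cut vertex, deleting one vertex leaves a single vertex,
    which is planar.\<close>
  have "card (pverts G) \<noteq> 2"
  proof
    assume "card (pverts G) = 2"
    then obtain u v where "pverts G = {u, v}" "u \<noteq> v"
      by (auto simp: card_2_iff)
    then have "pverts (delete_verts G {u}) = {v}"
      by auto
    then show False
      using planar_single_vertex[OF pair_graph_delete_verts[OF G]] NA \<open>pverts G = {u, v}\<close>
      by (metis insertI1)
  qed
  then obtain x where x: "x \<in> pverts G" "pverts G \<noteq> {x}"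
    and disc: "\<not> Digraph_Component.connected (with_proj (delete_verts G {x}))"
    using connectivity_eq_1(2)[OF G ne c] by blast
  have "pverts (delete_verts G {x}) \<noteq> {}"
    using x by auto
  from disconnected_partition[OF pair_graph_delete_verts[OF G] disc this]
  obtain A B where AB: "A \<noteq> {}" "B \<noteq> {}" "A \<inter> B = {}" "A \<union> B = pverts G - {x}"
    and sep: "\<And>u v. (u, v) \<in> parcs (delete_verts G {x}) \<Longrightarrow> u \<in> A \<longleftrightarrow> v \<in> A"
    by (metis delete_verts_simps(1))
  have V: "pverts G = insert x (A \<union> B)" and x_notin: "x \<notin> A" "x \<notin> B"
    using AB x(1) by auto
  have sepAB: "\<not> (u \<in> A \<and> v \<in> B)" "\<not> (u \<in> B \<and> v \<in> A)" if "(u, v) \<in> parcs G" for u v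
    using sep[of u v] that AB(3) x_notin by auto
  note conn = connectivity_eq_1(1)[OF G ne c]
  \<comment> \<open>Connectedness of \<open>G\<close> forces an arc out of \<open>C\<close>, and it
    can only lead to \<open>x\<close>.\<close>
  have side: "\<exists>a \<in> C. (a, x) \<in> parcs G"
    if C: "C \<noteq> {}" "C \<subseteq> pverts G" "x \<notin> C"
      and closed: "\<And>u v. (u, v) \<in> parcs G \<Longrightarrow> u \<in> C \<Longrightarrow> v \<in> insert x C" for C
  proof -
    obtain a where "a \<in> C"
      using C(1) by blast
    moreover have "x \<in> pverts G - C"
      using x(1) C(3) by blast
    ultimately obtain u v where "(u, v) \<in> parcs G" "u \<in> C" "v \<notin> C"
      using connected_arc_leaving[OF G conn C(2)] by metis
    then show ?thesis
      using closed by blast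
  qed
  obtain a where a: "a \<in> A" "(a, x) \<in> parcs G"
    using side[of A] AB(1) V x_notin(1) sepAB(1) wf(2) by blast
  obtain b where b: "b \<in> B" "(b, x) \<in> parcs G"
    using side[of B] AB(2) V x_notin(2) sepAB(2) wf(2) by blast
  \<comment> \<open>Both sides without \<open>x\<close> turn out planar, hence so does their
    disjoint union \<open>G - x\<close>, although \<open>G\<close> is not apex.\<close>
  have "planar (delete_verts G (insert x B))"
    using MMNA_cut_side_planar[OF M V x_notin AB(3,1,2) sepAB(1) a(2,1)] .
  moreover have "planar (delete_verts G (insert x A))"
    using MMNA_cut_side_planar[OF M _ x_notin(2,1) _ AB(2,1) sepAB(2) b(2,1)] V AB(3)
    by (simp add: Un_commute Int_commute)
  ultimately have "planar (delete_verts G {x})"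
  proof (rule planar_disjoint_union)
    show "pverts (delete_verts G {x}) =
        pverts (delete_verts G (insert x B)) \<union> pverts (delete_verts G (insert x A))"
      "pverts (delete_verts G (insert x B)) \<inter> pverts (delete_verts G (insert x A)) = {}"
      using V AB(3) x_notin by auto
    show "parcs (delete_verts G {x}) =
        parcs (delete_verts G (insert x B)) \<union> parcs (delete_verts G (insert x A))"
      using V AB(3) sepAB wf(1,2) by auto
  qed (simp_all add: pair_graph_delete_verts G)
  then show False
    using NA x(1) by blast
qed

end
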